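(* Let $p\in(1,\infty)\setminus\{2\}$ and let $x=(x_n)_{n\in\mathbb{N}}\in\ell_p$ be non-zero. Then the following are equivalent: (a) $x$ is a left-symmetric point; (b) $x$ is a right-symmetric point; (c) $x=ce_N$ for some $N\in\mathbb{N}$ and $c\in\mathbb{K}$, or $x=c_1e_N+c_2e_M$ for some $N,M\in\mathbb{N}$ and $c_1,c_2\in\mathbb{K}$ with $|c_1|=|c_2|$.
   Context: $\mathbb{K}$ is $\mathbb{R}$ or $\mathbb{C}$. $\ell_p$ is the space of $p$-summable sequences in $\mathbb{K}$ with norm $\|x\|_p=(\sum_n|x_n|^p)^{1/p}$. In a normed space $\mathbb{X}$ over $\mathbb{K}$, $x\perp_B y$ means $\|x+\lambda y\|\ge\|x\|$ for all $\lambda\in\mathbb{K}$. A point $x\in\mathbb{X}$ is left-symmetric (resp. right-symmetric) if for every $y\in\mathbb{X}$, $x\perp_B y\Rightarrow y\perp_B x$ (resp. $y\perp_B x\Rightarrow x\perp_B y$). $e_n$ is the sequence whose $n$-th term is $1$ and whose other terms are $0$. *)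

theory Defs
  imports "HOL-Analysis.Analysis" "HOL-Library.Function_Algebras"
begin

text \<open>
  Since \<open>p\<close> is a term, \<open>\<ell>\<^sub>p\<close> is a set of sequences with a norm function rather than a type. A normed
  space over \<open>'k\<close> is therefore given by a carrier \<open>V\<close>, a norm \<open>N\<close> and a scalar multiplication
  \<open>scl\<close>; the scalars range over the whole type \<open>'k\<close>. Addition and zero of sequences are the
  pointwise ones of \<open>Function_Algebras\<close>.
\<close>

definition bj_orthogonal ::
    "('v::ab_group_add \<Rightarrow> real) \<Rightarrow> ('k::real_normed_field \<Rightarrow> 'v \<Rightarrow> 'v) \<Rightarrow> 'v \<Rightarrow> 'v \<Rightarrow> bool" where
  "bj_orthogonal N scl x y \<longleftrightarrow> (\<forall>c. N (x + scl c y) \<ge> N x)"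

definition left_symmetric ::
    "'v::ab_group_add set \<Rightarrow> ('v \<Rightarrow> real) \<Rightarrow> ('k::real_normed_field \<Rightarrow> 'v \<Rightarrow> 'v) \<Rightarrow> 'v \<Rightarrow> bool" where
  "left_symmetric V N scl x \<longleftrightarrow>
     (\<forall>y\<in>V. bj_orthogonal N scl x y \<longrightarrow> bj_orthogonal N scl y x)"

definition right_symmetric ::
    "'v::ab_group_add set \<Rightarrow> ('v \<Rightarrow> real) \<Rightarrow> ('k::real_normed_field \<Rightarrow> 'v \<Rightarrow> 'v) \<Rightarrow> 'v \<Rightarrow> bool" where
  "right_symmetric V N scl x \<longleftrightarrow>
     (\<forall>y\<in>V. bj_orthogonal N scl y x \<longrightarrow> bj_orthogonal N scl x y)"

definition lp_space :: "real \<Rightarrow> (nat \<Rightarrow> 'k::real_normed_field) set" where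
  "lp_space p = {x. summable (\<lambda>n. norm (x n) powr p)}"

definition lp_norm :: "real \<Rightarrow> (nat \<Rightarrow> 'k::real_normed_field) \<Rightarrow> real" where
  "lp_norm p x = (\<Sum>n. norm (x n) powr p) powr (1 / p)"

definition seq_scale :: "'k::real_normed_field \<Rightarrow> (nat \<Rightarrow> 'k) \<Rightarrow> nat \<Rightarrow> 'k" where
  "seq_scale c x = (\<lambda>n. c * x n)"

definition unit_seq :: "nat \<Rightarrow> nat \<Rightarrow> 'k::real_normed_field" where
  "unit_seq N = (\<lambda>n. if n = N then 1 else 0)"

abbreviation lp_left_symmetric :: "real \<Rightarrow> (nat \<Rightarrow> 'k::real_normed_field) \<Rightarrow> bool" where
  "lp_left_symmetric p \<equiv>
     left_symmetric (lp_space p) (lp_norm p) (seq_scale :: 'k \<Rightarrow> (nat \<Rightarrow> 'k) \<Rightarrow> nat \<Rightarrow> 'k)"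

abbreviation lp_right_symmetric :: "real \<Rightarrow> (nat \<Rightarrow> 'k::real_normed_field) \<Rightarrow> bool" where
  "lp_right_symmetric p \<equiv>
     right_symmetric (lp_space p) (lp_norm p) (seq_scale :: 'k \<Rightarrow> (nat \<Rightarrow> 'k) \<Rightarrow> nat \<Rightarrow> 'k)"

end

theory Submission
  imports Defs
begin

text \<open>
  Orthogonality in \<open>\<ell>\<^sub>p\<close> is the vanishing of a functional. The norm is differentiable because
  \<open>p > 1\<close>, and \<open>norm (x + c * y)\<close> is convex in \<open>c\<close>, so \<open>c = 0\<close> is a minimum exactly if all
  directional derivatives there are zero, that is, if \<open>F x y = 0\<close> with
  \<open>F x y = (\<Sum>n. \<bar>x n\<bar> powr p * (y n / x n))\<close>. A quotient by \<open>0\<close> is \<open>0\<close>, and where \<open>x n \<noteq> 0\<close> the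
  term is the familiar \<open>\<bar>x n\<bar> powr (p - 2) * cnj (x n) * y n\<close>. This is lemma
  \<open>bj_orthogonal_lp_iff\<close>, for pairs whose common support is finite: there \<open>F\<close> is a finite sum,
  so no limit has to be exchanged with the derivative, and no other pairs occur below.

  Suppose that \<open>x\<close> is left- or right-symmetric, and test it against the vectors \<open>t n * sgn (x n)\<close> with
  \<open>t\<close> real and supported on a finite part of the support of \<open>x\<close>. Then
  \<open>F x y = 0\<close> says \<open>(\<Sum>n. t n * \<bar>x n\<bar> powr (p - 1)) = 0\<close>, and \<open>F y x = 0\<close> says
  \<open>(\<Sum>n. sgn (t n) * \<bar>t n\<bar> powr (p - 1) * \<bar>x n\<bar>) = 0\<close>. The substitution
  \<open>s n = sgn (t n) * \<bar>t n\<bar> powr (p - 1)\<close> exchanges the two conditions and replaces \<open>p - 1\<close> by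
  \<open>1 / (p - 1)\<close>, which is the duality of \<open>p\<close> with its conjugate exponent. Both symmetries are
  therefore instances of one implication between weighted sums, with exponent \<open>\<alpha> = p - 1\<close> or
  \<open>\<alpha> = 1 / (p - 1)\<close>; in both cases \<open>\<alpha> \<noteq> 1\<close>, as \<open>p \<noteq> 2\<close>. By \<open>signed_powr_implication_rigid\<close> a
  vector \<open>t\<close> with two entries forces the nonzero \<open>\<bar>x n\<bar>\<close> to be equal, and \<open>t = (1, 1, - 2)\<close> then
  excludes three of them.

  Conversely, if \<open>x\<close> has two nonzero entries \<open>x N\<close>, \<open>x M\<close> of equal norm, put \<open>a = y N / x N\<close> and
  \<open>b = y M / x M\<close>. Then \<open>x\<close> is orthogonal to \<open>y\<close> exactly if \<open>a + b = 0\<close>, and \<open>y\<close> to \<open>x\<close> exactly if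
  \<open>\<bar>a\<bar> powr p / a + \<bar>b\<bar> powr p / b = 0\<close>. The latter makes \<open>\<bar>a\<bar>\<close> and \<open>\<bar>b\<bar>\<close> equal, so the two conditions
  agree. If \<open>x\<close> has one nonzero entry \<open>x N\<close>, both relations mean \<open>y N = 0\<close>.

  The real and the complex case are treated together, over a normed field with an inner product
  that induces the norm. There \<open>inner 1 z\<close> plays the part of the real part of \<open>z\<close>.
\<close>

section \<open>Orthogonality as a vanishing functional\<close>

lemma norm_add_eq_norm_mult:
  fixes x h :: "'k::real_normed_field"
  assumes "x \<noteq> 0"
  shows "norm (x + h) = norm x * norm (1 + h / x)"
proof -
  have "x + h = x * (1 + h / x)"
    using assms by (simp add: distrib_left)
  then show ?thesis by (simp flip: norm_mult)
qed

text \<open>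
  The convex function \<open>\<lambda>h. norm (x + h) powr p\<close> lies above its tangent at \<open>0\<close>. Division by
  \<open>norm x powr p\<close> reduces this to \<open>x = 1\<close>, where Cauchy-Schwarz bounds \<open>1 + inner 1 h\<close> by
  \<open>u = norm (1 + h)\<close>, and Young's inequality for the product \<open>u * 1\<close> yields \<open>1 + p * (u - 1) \<le> u powr p\<close>.
\<close>

lemma norm_powr_ge_tangent:
  fixes x h :: "'k::{real_normed_field,real_inner}"
  assumes p: "1 < p"
  shows "norm x powr p + p * inner 1 (of_real (norm x powr p) * (h / x)) \<le> norm (x + h) powr p"
proof (cases "x = 0")
  case True
  then show ?thesis using p by simp
next
  case False
  define y where "y = norm (1 + h / x)"
  have "inner 1 (1 + h / x) \<le> y"
    using norm_cauchy_schwarz[of 1 "1 + h / x"] by (simp add: y_def)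
  then have 1: "1 + inner 1 (h / x) \<le> y"
    by (simp add: inner_add_right dot_square_norm)
  have "y * 1 \<le> y powr p / p + 1 powr (p / (p - 1)) / (p / (p - 1))"
    by (rule Youngs_inequality) (use p in \<open>auto simp: y_def field_simps\<close>)
  then have "p * y \<le> p * (y powr p / p + (p - 1) / p)"
    using p by simp
  then have "p * y \<le> y powr p + (p - 1)"
    using p by (simp add: distrib_left)
  moreover have "p * (1 + inner 1 (h / x)) \<le> p * y"
    using 1 p by simp
  ultimately have 2: "1 + p * inner 1 (h / x) \<le> y powr p"
    by (simp add: algebra_simps)
  have "norm (x + h) = norm x * y"
    using norm_add_eq_norm_mult[OF False] by (simp add: y_def)
  then have "norm (x + h) powr p = norm x powr p * y powr p"
    by (simp add: powr_mult y_def)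
  moreover have "norm x powr p * (1 + p * inner 1 (h / x)) \<le> norm x powr p * y powr p"
    using 2 by (intro mult_left_mono) auto
  ultimately show ?thesis
    unfolding inner_mult_right by (simp add: algebra_simps)
qed

lemma abs_powr_has_derivative_0:
  fixes p :: real
  assumes "1 < p"
  shows "((\<lambda>t. \<bar>t\<bar> powr p) has_real_derivative 0) (at 0)"
proof -
  have "((\<lambda>t::real. \<bar>t\<bar> powr (p - 1)) \<longlongrightarrow> \<bar>0\<bar> powr (p - 1)) (at 0)"
    by (rule tendsto_powr') (use assms in \<open>auto intro: always_eventually simp: tendsto_rabs_zero_iff\<close>)
  then have "((\<lambda>t::real. \<bar>t\<bar> powr (p - 1)) \<longlongrightarrow> 0) (at 0)"
    by simp
  moreover have "\<bar>t\<bar> powr (p - 1) = norm (\<bar>t\<bar> powr p / t)" if "t \<noteq> 0" for t :: real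
    using that by (simp add: powr_diff abs_divide)
  ultimately have "((\<lambda>t::real. norm (\<bar>t\<bar> powr p / t)) \<longlongrightarrow> 0) (at 0)"
    by (smt (verit, best) Lim_cong_within)
  then have "((\<lambda>t::real. \<bar>t\<bar> powr p / t) \<longlongrightarrow> 0) (at 0)"
    by (rule tendsto_norm_zero_cancel)
  then show ?thesis
    unfolding has_field_derivative_iff using assms by simp
qed

text \<open>
  For \<open>x \<noteq> 0\<close> the function is a power of the quadratic polynomial \<open>(norm (1 + t * (h / x)))\<^sup>2\<close> in
  \<open>t\<close>, which is positive near \<open>0\<close>; for \<open>x = 0\<close> it is a multiple of \<open>\<bar>t\<bar> powr p\<close>.
\<close>

lemma norm_powr_has_derivative_0:
  fixes x h :: "'k::{real_normed_field,real_inner}"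
  assumes p: "1 < p"
  shows "((\<lambda>t. norm (x + of_real t * h) powr p) has_real_derivative
            p * inner 1 (of_real (norm x powr p) * (h / x))) (at 0)"
proof (cases "x = 0")
  case True
  have "((\<lambda>t. \<bar>t\<bar> powr p * norm h powr p) has_real_derivative 0 * norm h powr p) (at 0)"
    by (intro DERIV_cmult_right abs_powr_has_derivative_0 p)
  then show ?thesis
    using True p by (simp add: norm_mult powr_mult)
next
  case False
  define a b where "a = inner 1 (h / x)" and "b = (norm (h / x))\<^sup>2"
  have eq: "norm (x + of_real t * h) powr p
      = norm x powr p * (1 + 2 * t * a + t\<^sup>2 * b) powr (p / 2)" for t
  proof -
    have "norm (x + of_real t * h) = norm x * norm (1 + of_real t * (h / x))"
      using norm_add_eq_norm_mult[OF False, of "of_real t * h"] by simp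
    moreover have "(norm (1 + of_real t * (h / x)))\<^sup>2 = 1 + 2 * t * a + t\<^sup>2 * b"
    proof -
      have "(norm (1 + w))\<^sup>2 = 1 + 2 * inner 1 w + (norm w)\<^sup>2" for w :: 'k
        using dot_norm[of 1 w] by simp
      then show ?thesis
        unfolding a_def b_def by (simp only: inner_mult_right norm_mult power_mult_distrib) simp
    qed
    then have "(1 + 2 * t * a + t\<^sup>2 * b) powr (p / 2) = norm (1 + of_real t * (h / x)) powr p"
      using powr_powr[of "norm (1 + of_real t * (h / x))" 2 "p / 2"] by simp
    ultimately show ?thesis
      by (simp add: powr_mult)
  qed
  have "((\<lambda>t. norm x powr p * (1 + 2 * t * a + t\<^sup>2 * b) powr (p / 2)) has_real_derivative
            norm x powr p * (p * a)) (at 0)"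
    by (auto intro!: derivative_eq_intros)
  then show ?thesis
    unfolding eq a_def inner_mult_right by (simp add: algebra_simps)
qed

text \<open>
  Off the set \<open>S\<close> the supports of \<open>x\<close> and \<open>y\<close> are disjoint, so there the two sequences contribute
  separately: \<open>A\<close> collects the tail of \<open>x\<close> and \<open>B\<close> that of \<open>y\<close>. The dependence on \<open>c\<close> is thereby
  confined to a finite sum and the term \<open>norm c powr p * B\<close>.
\<close>

lemma lp_norm_powr_sums:
  fixes x y :: "nat \<Rightarrow> 'k::real_normed_field"
  assumes x: "x \<in> lp_space p" and y: "y \<in> lp_space p" and S: "finite S"
    and off: "\<And>n. n \<notin> S \<Longrightarrow> x n = 0 \<or> y n = 0" and p: "1 < p"
  shows "\<exists>A B. 0 \<le> B \<and> (\<forall>c. (\<lambda>n. norm (x n + c * y n) powr p) sums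
            ((\<Sum>n\<in>S. norm (x n + c * y n) powr p) + A + norm c powr p * B))"
proof -
  define restr where "restr = (\<lambda>(z :: nat \<Rightarrow> 'k) n. if n \<in> S then 0 else norm (z n) powr p)"
  have summable: "summable (restr z)" if "z \<in> lp_space p" for z
    by (rule summable_comparison_test'[where g = "\<lambda>n. norm (z n) powr p" and N = 0])
      (use that in \<open>auto simp: lp_space_def restr_def\<close>)
  have split: "norm (x n + c * y n) powr p =
      (if n \<in> S then norm (x n + c * y n) powr p else 0) + restr x n + norm c powr p * restr y n"
    for n c
    using off[of n] p by (auto simp: restr_def norm_mult powr_mult)
  have "(\<lambda>n. norm (x n + c * y n) powr p) sums ((\<Sum>n\<in>S. norm (x n + c * y n) powr p)
            + suminf (restr x) + norm c powr p * suminf (restr y))" for c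
    by (subst split) (intro sums_add sums_mult sums_If_finite_set S summable_sums summable x y)
  moreover have "0 \<le> suminf (restr y)"
    by (intro suminf_nonneg summable y) (auto simp: restr_def)
  ultimately show ?thesis by blast
qed

text \<open>
  If the functional vanishes, the sum of the tangent inequalities shows that \<open>c = 0\<close> is a minimum.
  Conversely, at a minimum the derivative vanishes along every line \<open>t \<mapsto> t * c\<close>. The tail of
  \<open>y\<close> enters only through \<open>\<bar>t\<bar> powr p\<close>, whose derivative at \<open>0\<close> is zero because \<open>p > 1\<close>.
\<close>

lemma bj_orthogonal_lp_iff:
  fixes x y :: "nat \<Rightarrow> 'k::{real_normed_field,real_inner}"
  assumes x: "x \<in> lp_space p" and y: "y \<in> lp_space p" and S: "finite S"
    and off: "\<And>n. n \<notin> S \<Longrightarrow> x n = 0 \<or> y n = 0" and p: "1 < p"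
  shows "bj_orthogonal (lp_norm p) (seq_scale :: 'k \<Rightarrow> _) x y \<longleftrightarrow>
           (\<Sum>n\<in>S. of_real (norm (x n) powr p) * (y n / x n)) = 0"
    (is "?orth \<longleftrightarrow> ?F = 0")
proof -
  obtain A B where B: "0 \<le> B" and sums: "\<And>c. (\<lambda>n. norm (x n + c * y n) powr p) sums
            ((\<Sum>n\<in>S. norm (x n + c * y n) powr p) + A + norm c powr p * B)"
    using lp_norm_powr_sums[OF x y S off p] by blast
  define G where "G = (\<lambda>c. (\<Sum>n\<in>S. norm (x n + c * y n) powr p) + norm c powr p * B)"
  have norm_eq: "lp_norm p (x + seq_scale c y) = (G c + A) powr (1 / p)" and nonneg: "0 \<le> G c + A" for c
  proof -
    have "(\<lambda>n. norm (x n + c * y n) powr p) sums (G c + A)"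
      using sums[of c] by (simp add: G_def algebra_simps)
    then show "lp_norm p (x + seq_scale c y) = (G c + A) powr (1 / p)" and "0 \<le> G c + A"
      by (auto simp: lp_norm_def seq_scale_def sums_iff dest: suminf_nonneg)
  qed
  have "lp_norm p x = (G 0 + A) powr (1 / p)"
    using norm_eq[of 0] by (simp add: seq_scale_def plus_fun_def)
  moreover have "(G 0 + A) powr (1 / p) \<le> (G c + A) powr (1 / p) \<longleftrightarrow> G 0 \<le> G c" for c
    using powr_mono2[of "1 / p" "G 0 + A" "G c + A"] powr_less_mono2[of "1 / p" "G c + A" "G 0 + A"]
      nonneg[of 0] nonneg[of c] p by (auto simp: not_le[symmetric])
  ultimately have orth_iff: "?orth \<longleftrightarrow> (\<forall>c. G 0 \<le> G c)"
    unfolding bj_orthogonal_def norm_eq by simp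
  have inner_F: "(\<Sum>n\<in>S. inner 1 (of_real (norm (x n) powr p) * (c * y n / x n))) = inner 1 (c * ?F)" for c
    by (simp add: inner_sum_right sum_distrib_left mult_ac)
  show ?thesis
  proof
    assume F: "?F = 0"
    have "G 0 \<le> G c" for c
    proof -
      have "(\<Sum>n\<in>S. norm (x n) powr p
              + p * inner 1 (of_real (norm (x n) powr p) * (c * y n / x n)))
            \<le> (\<Sum>n\<in>S. norm (x n + c * y n) powr p)"
        by (intro sum_mono norm_powr_ge_tangent p)
      then have "(\<Sum>n\<in>S. norm (x n) powr p) \<le> (\<Sum>n\<in>S. norm (x n + c * y n) powr p)"
        by (simp only: sum.distrib sum_distrib_left[symmetric] inner_F F) simp
      then show ?thesis
        using B p by (simp add: G_def add_increasing2)
    qed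
    then show ?orth
      by (simp add: orth_iff)
  next
    assume ?orth
    then have min: "G 0 \<le> G c" for c
      by (simp add: orth_iff)
    have zero: "inner 1 (c * ?F) = 0" for c
    proof -
      have "((\<lambda>t. (\<Sum>n\<in>S. norm (x n + of_real t * (c * y n)) powr p) + \<bar>t\<bar> powr p * (norm c powr p * B))
          has_real_derivative (\<Sum>n\<in>S. p * inner 1 (of_real (norm (x n) powr p) * (c * y n / x n)))
            + 0 * (norm c powr p * B)) (at 0)"
        by (intro DERIV_add DERIV_sum DERIV_cmult_right norm_powr_has_derivative_0
            abs_powr_has_derivative_0 p)
      also have "(\<lambda>t. (\<Sum>n\<in>S. norm (x n + of_real t * (c * y n)) powr p) + \<bar>t\<bar> powr p * (norm c powr p * B))
          = (\<lambda>t. G (of_real t * c))"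
        by (auto simp: G_def norm_mult powr_mult mult_ac)
      also have "(\<Sum>n\<in>S. p * inner 1 (of_real (norm (x n) powr p) * (c * y n / x n))) + 0 * (norm c powr p * B)
          = p * inner 1 (c * ?F)"
        by (simp only: sum_distrib_left[symmetric] inner_F mult_zero_left add_0_right)
      finally have "p * inner 1 (c * ?F) = 0"
        by (rule DERIV_local_min[where d = 1]) (simp_all add: min)
      then show ?thesis
        using p by simp
    qed
    \<comment> \<open>The directions \<open>c\<close> range over the whole field, so one of them turns \<open>c * ?F\<close> into \<open>1\<close>.\<close>
    show "?F = 0"
    proof (rule ccontr)
      assume "?F \<noteq> 0"
      then show False
        using zero[of "inverse ?F"] by (simp add: dot_square_norm)
    qed
  qed
qed

section \<open>Test vectors and the entries of a symmetric point\<close>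

text \<open>
  Giving \<open>y n\<close> the phase of \<open>x n\<close> makes every term of the functional real, in both orders of \<open>x\<close>
  and \<open>y\<close>. The scalars \<open>t n\<close> then satisfy one real equation for each order.
\<close>

definition aligned_seq :: "nat set \<Rightarrow> (nat \<Rightarrow> 'k::real_normed_field) \<Rightarrow> (nat \<Rightarrow> real) \<Rightarrow> nat \<Rightarrow> 'k" where
  "aligned_seq S x t = (\<lambda>n. if n \<in> S then of_real (t n) * sgn (x n) else 0)"

lemma aligned_seq_in_lp_space:
  assumes "finite S"
  shows "aligned_seq S x t \<in> lp_space p"
  unfolding lp_space_def mem_Collect_eq
  by (rule summable_finite[OF assms]) (simp add: aligned_seq_def)

lemma bj_orthogonal_aligned_seq_iff:
  fixes x :: "nat \<Rightarrow> 'k::{real_normed_field,real_inner}"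
  assumes x: "x \<in> lp_space p" and S: "finite S" "S \<subseteq> {n. x n \<noteq> 0}" and p: "1 < p"
  shows "bj_orthogonal (lp_norm p) (seq_scale :: 'k \<Rightarrow> _) x (aligned_seq S x t) \<longleftrightarrow>
           (\<Sum>n\<in>S. t n * norm (x n) powr (p - 1)) = 0"
proof -
  have "of_real (norm (x n) powr p) * (aligned_seq S x t n / x n)
      = (of_real (t n * norm (x n) powr (p - 1)) :: 'k)" if "n \<in> S" for n
    using that S by (auto simp: aligned_seq_def sgn_div_norm scaleR_conv_of_real powr_diff divide_simps)
  then have "(\<Sum>n\<in>S. of_real (norm (x n) powr p) * (aligned_seq S x t n / x n))
      = (of_real (\<Sum>n\<in>S. t n * norm (x n) powr (p - 1)) :: 'k)"
    by simp
  then show ?thesis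
    by (subst bj_orthogonal_lp_iff[OF x aligned_seq_in_lp_space[OF S(1)] S(1) _ p])
      (simp_all add: aligned_seq_def del: of_real_sum)
qed

lemma aligned_seq_bj_orthogonal_iff:
  fixes x :: "nat \<Rightarrow> 'k::{real_normed_field,real_inner}"
  assumes x: "x \<in> lp_space p" and S: "finite S" "S \<subseteq> {n. x n \<noteq> 0}" and p: "1 < p"
  shows "bj_orthogonal (lp_norm p) (seq_scale :: 'k \<Rightarrow> _) (aligned_seq S x t) x \<longleftrightarrow>
           (\<Sum>n\<in>S. sgn (t n) * \<bar>t n\<bar> powr (p - 1) * norm (x n)) = 0"
proof -
  have "of_real (norm (aligned_seq S x t n) powr p) * (x n / aligned_seq S x t n)
      = (of_real (sgn (t n) * \<bar>t n\<bar> powr (p - 1) * norm (x n)) :: 'k)" if "n \<in> S" for n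
  proof (cases "t n = 0")
    case True
    then show ?thesis by (simp add: aligned_seq_def)
  next
    case False
    have "x n \<noteq> 0" using that S by auto
    then have "norm (aligned_seq S x t n) = \<bar>t n\<bar>"
      using that by (simp add: aligned_seq_def norm_mult norm_sgn)
    moreover have "x n / aligned_seq S x t n = of_real (norm (x n) / t n)"
      using that False \<open>x n \<noteq> 0\<close>
      by (simp add: aligned_seq_def sgn_div_norm scaleR_conv_of_real divide_simps)
    moreover have "\<bar>t n\<bar> powr p * (norm (x n) / t n) = sgn (t n) * \<bar>t n\<bar> powr (p - 1) * norm (x n)"
      using False by (auto simp: powr_diff sgn_if abs_if)
    ultimately show ?thesis
      by (metis of_real_mult)
  qed
  then have "(\<Sum>n\<in>S. of_real (norm (aligned_seq S x t n) powr p) * (x n / aligned_seq S x t n))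
      = (of_real (\<Sum>n\<in>S. sgn (t n) * \<bar>t n\<bar> powr (p - 1) * norm (x n)) :: 'k)"
    by simp
  then show ?thesis
    by (subst bj_orthogonal_lp_iff[OF aligned_seq_in_lp_space[OF S(1)] x S(1) _ p])
      (simp_all add: aligned_seq_def del: of_real_sum)
qed

text \<open>
  With weights \<open>w i = norm (x i) powr (p - 1)\<close> and \<open>\<alpha> = p - 1\<close> the implication expresses
  left-symmetry of \<open>x\<close> on aligned vectors, and with \<open>w i = norm (x i)\<close> and \<open>\<alpha> = 1 / (p - 1)\<close>
  right-symmetry. The vector with entries \<open>w j\<close> at \<open>i\<close> and \<open>- w i\<close> at \<open>j\<close> yields
  \<open>(w j / w i) powr (\<alpha> - 1 / \<alpha>) = 1\<close>, hence equal weights. Once the weights are equal, the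
  entries \<open>1, 1, - 2\<close> yield \<open>2 = 2 powr \<alpha>\<close>, which \<open>\<alpha> \<noteq> 1\<close> rules out.
\<close>

lemma signed_powr_implication_rigid:
  fixes w :: "'i \<Rightarrow> real" and \<alpha> :: real
  assumes \<alpha>: "0 < \<alpha>" "\<alpha> \<noteq> 1" and w: "\<And>i. i \<in> I \<Longrightarrow> 0 < w i"
    and imp: "\<And>S t. finite S \<Longrightarrow> S \<subseteq> I \<Longrightarrow> (\<Sum>i\<in>S. t i * w i) = 0 \<Longrightarrow>
                (\<Sum>i\<in>S. sgn (t i) * \<bar>t i\<bar> powr \<alpha> * w i powr (1 / \<alpha>)) = 0"
  shows "i \<in> I \<Longrightarrow> j \<in> I \<Longrightarrow> w i = w j"
    and "i \<in> I \<Longrightarrow> j \<in> I \<Longrightarrow> k \<in> I \<Longrightarrow> i = j \<or> i = k \<or> j = k"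
proof -
  show eq: "w i = w j" if ij: "i \<in> I" "j \<in> I" for i j
  proof (rule ccontr)
    assume neq: "w i \<noteq> w j"
    then have "i \<noteq> j" by blast
    note pos = w[OF ij(1)] w[OF ij(2)]
    have "w j powr \<alpha> * w i powr (1 / \<alpha>) = w i powr \<alpha> * w j powr (1 / \<alpha>)"
      using imp[of "{i, j}" "\<lambda>n. if n = i then w j else - w i"] ij \<open>i \<noteq> j\<close> pos
      by (simp add: algebra_simps)
    \<comment> \<open>Logarithms turn the equation of powers into a linear one in \<open>ln (w i)\<close> and \<open>ln (w j)\<close>.\<close>
    then have "ln (w j powr \<alpha> * w i powr (1 / \<alpha>)) = ln (w i powr \<alpha> * w j powr (1 / \<alpha>))"
      by simp
    then have "(\<alpha> - 1 / \<alpha>) * (ln (w j) - ln (w i)) = 0"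
      using pos by (simp add: ln_mult ln_powr algebra_simps)
    moreover have "ln (w j) \<noteq> ln (w i)"
      using neq pos by simp
    ultimately have "\<alpha> - 1 / \<alpha> = 0"
      by simp
    then have "\<alpha> * \<alpha> = 1"
      using \<alpha> by (simp add: field_simps)
    then show False
      using \<alpha> square_eq_1_iff[of \<alpha>] by auto
  qed
  show "i = j \<or> i = k \<or> j = k" if ijk: "i \<in> I" "j \<in> I" "k \<in> I" for i j k
  proof (rule ccontr)
    assume "\<not> ?thesis"
    then have "2 * w i powr (1 / \<alpha>) = 2 powr \<alpha> * w i powr (1 / \<alpha>)"
      using imp[of "{i, j, k}" "\<lambda>n. if n = k then -2 else 1"] ijk eq[of j i] eq[of k i]
      by (simp add: algebra_simps)
    then have "2 powr 1 = (2::real) powr \<alpha>"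
      using w[OF ijk(1)] by simp
    then show False
      using \<alpha> by (subst (asm) powr_inj) auto
  qed
qed

definition one_or_two_equal_terms :: "(nat \<Rightarrow> 'k::real_normed_field) \<Rightarrow> bool" where
  "one_or_two_equal_terms x \<longleftrightarrow>
     (\<exists>N c. x = seq_scale c (unit_seq N)) \<or>
     (\<exists>N M c\<^sub>1 c\<^sub>2. x = seq_scale c\<^sub>1 (unit_seq N) + seq_scale c\<^sub>2 (unit_seq M)
        \<and> norm c\<^sub>1 = norm c\<^sub>2)"

lemma one_or_two_equal_termsI:
  fixes x :: "nat \<Rightarrow> 'k::real_normed_field"
  assumes "x \<noteq> 0" and eq: "\<And>i j. x i \<noteq> 0 \<Longrightarrow> x j \<noteq> 0 \<Longrightarrow> norm (x i) = norm (x j)"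
    and three: "\<And>i j k. x i \<noteq> 0 \<Longrightarrow> x j \<noteq> 0 \<Longrightarrow> x k \<noteq> 0 \<Longrightarrow> i = j \<or> i = k \<or> j = k"
  shows "one_or_two_equal_terms x"
proof -
  obtain N where N: "x N \<noteq> 0"
    using \<open>x \<noteq> 0\<close> by (auto simp: fun_eq_iff)
  show ?thesis
  proof (cases "\<exists>M. M \<noteq> N \<and> x M \<noteq> 0")
    case True
    then obtain M where M: "M \<noteq> N" "x M \<noteq> 0" by blast
    then have "x n = 0" if "n \<noteq> N" "n \<noteq> M" for n
      using three[of N M n] that N by auto
    then have "x = seq_scale (x N) (unit_seq N) + seq_scale (x M) (unit_seq M)"
      using M by (auto simp: fun_eq_iff seq_scale_def unit_seq_def)
    then show ?thesis
      using eq[OF N M(2)] unfolding one_or_two_equal_terms_def by blast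
  next
    case False
    then have "x = seq_scale (x N) (unit_seq N)"
      by (auto simp: fun_eq_iff seq_scale_def unit_seq_def)
    then show ?thesis
      unfolding one_or_two_equal_terms_def by blast
  qed
qed

lemma left_symmetric_imp_one_or_two_equal_terms:
  fixes x :: "nat \<Rightarrow> 'k::{real_normed_field,real_inner}"
  assumes p: "1 < p" "p \<noteq> 2" and x: "x \<in> lp_space p" "x \<noteq> 0" and sym: "lp_left_symmetric p x"
  shows "one_or_two_equal_terms x"
proof -
  define w where "w = (\<lambda>n. norm (x n) powr (p - 1))"
  have w_root: "w n powr (1 / (p - 1)) = norm (x n)" for n
    using p by (simp add: w_def powr_powr)
  have imp: "(\<Sum>i\<in>S. sgn (t i) * \<bar>t i\<bar> powr (p - 1) * w i powr (1 / (p - 1))) = 0"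
    if "finite S" "S \<subseteq> {n. x n \<noteq> 0}" "(\<Sum>i\<in>S. t i * w i) = 0" for S t
  proof -
    have "bj_orthogonal (lp_norm p) (seq_scale :: 'k \<Rightarrow> _) x (aligned_seq S x t)"
      using that by (simp add: bj_orthogonal_aligned_seq_iff x p w_def)
    then have "bj_orthogonal (lp_norm p) (seq_scale :: 'k \<Rightarrow> _) (aligned_seq S x t) x"
      using sym aligned_seq_in_lp_space[OF that(1)] unfolding left_symmetric_def by blast
    then show ?thesis
      using that unfolding w_root by (simp add: aligned_seq_bj_orthogonal_iff x p)
  qed
  note rigid = signed_powr_implication_rigid[where \<alpha> = "p - 1" and w = w and I = "{n. x n \<noteq> 0}",
      OF _ _ _ imp]
  show ?thesis
  proof (rule one_or_two_equal_termsI[OF x(2)])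
    show "norm (x i) = norm (x j)" if "x i \<noteq> 0" "x j \<noteq> 0" for i j
    proof -
      have "w i = w j"
        by (rule rigid(1)) (use that p in \<open>auto simp: w_def\<close>)
      then show ?thesis
        by (metis w_root)
    qed
    show "i = j \<or> i = k \<or> j = k" if "x i \<noteq> 0" "x j \<noteq> 0" "x k \<noteq> 0" for i j k
      by (rule rigid(2)) (use that p in \<open>auto simp: w_def\<close>)
  qed
qed

text \<open>
  In the coordinates \<open>s i = sgn (t i) * \<bar>t i\<bar> powr (p - 1)\<close> the hypothesis that the test vector is
  orthogonal to \<open>x\<close> becomes linear, and the conclusion acquires the inverse exponent.
\<close>

lemma right_symmetric_imp_one_or_two_equal_terms:
  fixes x :: "nat \<Rightarrow> 'k::{real_normed_field,real_inner}"
  assumes p: "1 < p" "p \<noteq> 2" and x: "x \<in> lp_space p" "x \<noteq> 0" and sym: "lp_right_symmetric p x"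
  shows "one_or_two_equal_terms x"
proof -
  define \<alpha> where "\<alpha> = 1 / (p - 1)"
  have \<alpha>: "0 < \<alpha>" "\<alpha> \<noteq> 1" "1 / \<alpha> = p - 1"
    using p by (auto simp: \<alpha>_def)
  \<comment> \<open>The test vector \<open>t\<close> is the preimage of \<open>s\<close> under the signed power with exponent \<open>p - 1\<close>.\<close>
  have imp: "(\<Sum>i\<in>S. sgn (s i) * \<bar>s i\<bar> powr \<alpha> * norm (x i) powr (1 / \<alpha>)) = 0"
    if "finite S" "S \<subseteq> {n. x n \<noteq> 0}" "(\<Sum>i\<in>S. s i * norm (x i)) = 0" for S s
  proof -
    define t where "t = (\<lambda>i. sgn (s i) * \<bar>s i\<bar> powr \<alpha>)"
    have "sgn (t i) * \<bar>t i\<bar> powr (p - 1) = s i" for i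
      using p by (cases "s i = 0") (auto simp: t_def sgn_mult abs_mult powr_powr \<alpha>_def sgn_mult_abs)
    then have "bj_orthogonal (lp_norm p) (seq_scale :: 'k \<Rightarrow> _) (aligned_seq S x t) x"
      using that by (simp add: aligned_seq_bj_orthogonal_iff x p)
    then have "bj_orthogonal (lp_norm p) (seq_scale :: 'k \<Rightarrow> _) x (aligned_seq S x t)"
      using sym aligned_seq_in_lp_space[OF that(1)] unfolding right_symmetric_def by blast
    then show ?thesis
      using that by (simp add: bj_orthogonal_aligned_seq_iff x p \<alpha>(3) t_def)
  qed
  note rigid = signed_powr_implication_rigid[where \<alpha> = \<alpha> and w = "\<lambda>n. norm (x n)"
      and I = "{n. x n \<noteq> 0}", OF \<alpha>(1,2) _ imp]
  show ?thesis
  proof (rule one_or_two_equal_termsI[OF x(2)])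
    show "norm (x i) = norm (x j)" if "x i \<noteq> 0" "x j \<noteq> 0" for i j
      by (rule rigid(1)) (use that in auto)
    show "i = j \<or> i = k \<or> j = k" if "x i \<noteq> 0" "x j \<noteq> 0" "x k \<noteq> 0" for i j k
      by (rule rigid(2)) (use that in auto)
  qed
qed

section \<open>Symmetry of points with one or two equal entries\<close>

text \<open>
  A normal form that covers both alternatives: a single term is the case \<open>x M = 0\<close>, and coinciding
  indices in the two-term form merge into a single term.
\<close>

lemma one_or_two_equal_termsE:
  fixes x :: "nat \<Rightarrow> 'k::real_normed_field"
  assumes "one_or_two_equal_terms x" "x \<noteq> 0"
  obtains N M where "N \<noteq> M" "x N \<noteq> 0" "x M = 0 \<or> norm (x N) = norm (x M)"
    "\<And>n. n \<notin> {N, M} \<Longrightarrow> x n = 0"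
proof -
  from assms(1) consider (one) N c where "x = seq_scale c (unit_seq N)"
    | (two) N M c d where "N \<noteq> M" "x = seq_scale c (unit_seq N) + seq_scale d (unit_seq M)"
      "norm c = norm d"
    unfolding one_or_two_equal_terms_def
  proof (elim disjE exE conjE)
    fix N M c d
    assume *: "x = seq_scale c (unit_seq N) + seq_scale d (unit_seq M)" "norm c = norm d"
    show thesis
    proof (cases "N = M")
      case True
      then have "x = seq_scale (c + d) (unit_seq N)"
        using * by (simp add: fun_eq_iff seq_scale_def distrib_right)
      then show ?thesis by (rule one)
    qed (use two * in blast)
  qed (use one in blast)
  then show ?thesis
  proof cases
    case one
    then have "c \<noteq> 0"
      using assms(2) by (auto simp: fun_eq_iff seq_scale_def)
    then show ?thesis
      using that[of N "Suc N"] one by (simp add: seq_scale_def unit_seq_def)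
  next
    case two
    then have "c \<noteq> 0"
      using assms(2) by (auto simp: fun_eq_iff seq_scale_def)
    then show ?thesis
      using that[of N M] two by (simp add: seq_scale_def unit_seq_def)
  qed
qed

text \<open>
  Since \<open>norm (norm a powr p / a) = norm a powr (p - 1)\<close>, the left equation forces
  \<open>norm a = norm b\<close>. The common factor then cancels and \<open>1 / a + 1 / b = 0\<close> remains.
\<close>

lemma norm_powr_divide_sum_eq_0_iff:
  fixes a b :: "'k::real_normed_field"
  assumes "p \<noteq> 1"
  shows "of_real (norm a powr p) / a + of_real (norm b powr p) / b = 0 \<longleftrightarrow> a + b = 0"
proof
  assume "a + b = 0"
  then have "b = - a"
    by (simp add: eq_neg_iff_add_eq_0 add.commute)
  then show "of_real (norm a powr p) / a + of_real (norm b powr p) / b = 0"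
    by simp
next
  assume sum: "of_real (norm a powr p) / a + of_real (norm b powr p) / b = 0"
  then have "of_real (norm a powr p) / a = - (of_real (norm b powr p) / b)"
    by (simp add: eq_neg_iff_add_eq_0)
  then have "norm (of_real (norm a powr p) / a) = norm (of_real (norm b powr p) / b)"
    by simp
  then have "norm a powr (p - 1) = norm b powr (p - 1)"
    by (simp add: norm_divide powr_diff)
  then have "(norm a powr (p - 1)) powr (1 / (p - 1)) = (norm b powr (p - 1)) powr (1 / (p - 1))"
    by simp
  then have norm_eq: "norm a = norm b"
    using assms by (simp add: powr_powr)
  show "a + b = 0"
  proof (cases "a = 0")
    case True
    then show ?thesis using norm_eq by simp
  next
    case False
    then have "b \<noteq> 0" using norm_eq by auto
    moreover have "of_real (norm a powr p) \<noteq> (0::'k)"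
      using False by simp
    moreover have "of_real (norm a powr p) * (1 / a + 1 / b) = 0"
      using sum by (simp add: norm_eq distrib_left)
    ultimately have "1 / a + 1 / b = 0"
      by simp
    then show ?thesis
      using False \<open>b \<noteq> 0\<close> by (simp add: field_simps)
  qed
qed

text \<open>
  If \<open>x N\<close> and \<open>x M\<close> are both nonzero, then in the coordinates \<open>a = y N / x N\<close> and
  \<open>b = y M / x M\<close> the weights \<open>norm (x N) powr p\<close> and
  \<open>norm (x M) powr p\<close> are equal and cancel, which leaves the two conditions on \<open>a\<close> and \<open>b\<close> compared in
  \<open>norm_powr_divide_sum_eq_0_iff\<close>.
\<close>

lemma bj_orthogonal_sym_if_one_or_two_equal_terms:
  fixes x y :: "nat \<Rightarrow> 'k::{real_normed_field,real_inner}"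
  assumes p: "1 < p" and x: "x \<in> lp_space p" "x \<noteq> 0" "one_or_two_equal_terms x"
    and y: "y \<in> lp_space p"
  shows "bj_orthogonal (lp_norm p) (seq_scale :: 'k \<Rightarrow> _) x y \<longleftrightarrow>
         bj_orthogonal (lp_norm p) (seq_scale :: 'k \<Rightarrow> _) y x"
proof -
  obtain N M where NM: "N \<noteq> M" "x N \<noteq> 0" and eq: "x M = 0 \<or> norm (x N) = norm (x M)"
    and off: "\<And>n. n \<notin> {N, M} \<Longrightarrow> x n = 0"
    using one_or_two_equal_termsE[OF x(3,2)] by metis
  define a b where "a = y N / x N" and "b = y M / x M"
  have y_eq: "norm (y N) powr p = norm (x N) powr p * norm a powr p" "x N / y N = 1 / a"
    using NM by (simp_all add: a_def norm_divide powr_divide)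
  have xy: "bj_orthogonal (lp_norm p) (seq_scale :: 'k \<Rightarrow> _) x y \<longleftrightarrow>
      of_real (norm (x N) powr p) * a + of_real (norm (x M) powr p) * b = 0"
    by (subst bj_orthogonal_lp_iff[OF x(1) y, of "{N, M}"]) (use NM p off in \<open>auto simp: a_def b_def\<close>)
  have yx: "bj_orthogonal (lp_norm p) (seq_scale :: 'k \<Rightarrow> _) y x \<longleftrightarrow>
      of_real (norm (y N) powr p) * (x N / y N) + of_real (norm (y M) powr p) * (x M / y M) = 0"
    by (subst bj_orthogonal_lp_iff[OF y x(1), of "{N, M}"]) (use NM p off in auto)
  show ?thesis
  \<comment> \<open>For \<open>x M = 0\<close> both conditions reduce to \<open>y N = 0\<close>.\<close>
  proof (cases "x M = 0")
    case True
    then show ?thesis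
      unfolding xy yx using NM p by (auto simp: a_def)
  next
    case False
    then have r: "norm (x M) = norm (x N)" using eq by simp
    have "norm (y M) powr p = norm (x N) powr p * norm b powr p" "x M / y M = 1 / b"
      using NM False r by (simp_all add: b_def norm_divide powr_divide)
    then have "of_real (norm (y N) powr p) * (x N / y N) + of_real (norm (y M) powr p) * (x M / y M)
       = of_real (norm (x N) powr p) * (of_real (norm a powr p) / a + of_real (norm b powr p) / b)"
      unfolding y_eq by (simp add: distrib_left)
    moreover have "of_real (norm (x N) powr p) * a + of_real (norm (x M) powr p) * b
       = of_real (norm (x N) powr p) * (a + b)"
      by (simp add: r distrib_left)
    ultimately show ?thesis
      unfolding xy yx using NM p by (simp add: norm_powr_divide_sum_eq_0_iff)
  qed
qed

section \<open>The characterisation\<close>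

lemma lp_symmetric_iff_one_or_two_equal_terms:
  fixes x :: "nat \<Rightarrow> 'k::{real_normed_field,real_inner}"
  assumes p: "1 < p" "p \<noteq> 2" and x: "x \<in> lp_space p" "x \<noteq> 0"
  shows "lp_left_symmetric p x \<longleftrightarrow> one_or_two_equal_terms x"
    and "lp_right_symmetric p x \<longleftrightarrow> one_or_two_equal_terms x"
  using left_symmetric_imp_one_or_two_equal_terms[OF p x]
    right_symmetric_imp_one_or_two_equal_terms[OF p x]
    bj_orthogonal_sym_if_one_or_two_equal_terms[OF p(1) x]
  unfolding left_symmetric_def right_symmetric_def by blast+

theorem theorem4p4:
  fixes p :: real
  assumes "1 < p" and "p \<noteq> 2"
  shows "(\<forall>x \<in> (lp_space p :: (nat \<Rightarrow> real) set). x \<noteq> 0 \<longrightarrow>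
           (lp_left_symmetric p x \<longleftrightarrow> lp_right_symmetric p x) \<and>
           (lp_right_symmetric p x \<longleftrightarrow>
              (\<exists>N c. x = seq_scale c (unit_seq N)) \<or>
              (\<exists>N M c\<^sub>1 c\<^sub>2. x = seq_scale c\<^sub>1 (unit_seq N) + seq_scale c\<^sub>2 (unit_seq M)
                 \<and> norm c\<^sub>1 = norm c\<^sub>2))) \<and>
         (\<forall>x \<in> (lp_space p :: (nat \<Rightarrow> complex) set). x \<noteq> 0 \<longrightarrow>
           (lp_left_symmetric p x \<longleftrightarrow> lp_right_symmetric p x) \<and>
           (lp_right_symmetric p x \<longleftrightarrow>
              (\<exists>N c. x = seq_scale c (unit_seq N)) \<or>
              (\<exists>N M c\<^sub>1 c\<^sub>2. x = seq_scale c\<^sub>1 (unit_seq N) + seq_scale c\<^sub>2 (unit_seq M)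
                 \<and> norm c\<^sub>1 = norm c\<^sub>2)))"
  using lp_symmetric_iff_one_or_two_equal_terms[OF assms, where 'k = real]
    lp_symmetric_iff_one_or_two_equal_terms[OF assms, where 'k = complex]
  unfolding one_or_two_equal_terms_def by simp

end
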